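(* Let $\mathcal{S}$ be a self-adjoint (multiplicative) semigroup of trace-class operators on the real or complex Hilbert space $l^2$ such that the set $\{ \operatorname{tr} S : S \in \mathcal{S} \}$ is finite. If $\mathcal{S}$ contains only finitely many projections, then $\mathcal{S}$ is finite.
   Context: A collection $\mathcal{C}$ of bounded operators on $l^2$ is called self-adjoint if $T \in \mathcal{C}$ implies $T^* \in \mathcal{C}$. A projection is a self-adjoint idempotent. A semigroup of operators is a set of bounded operators closed under multiplication (composition). *)

theory Defs
  imports "HOL-Analysis.Analysis"
begin

text \<open>
  The scalar field is real or complex. The class \<open>rc_field\<close> captures both cases at once:
  its instances are the real numbers (with trivial conjugation) and the complex numbers, and
  lemma \<open>rc_field_cases\<close> below shows that there are no others up to isomorphism.
\<close>

class rc_field = real_normed_field + banach +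
  fixes rcnj :: "'a \<Rightarrow> 'a"
  assumes rcnj_add: "rcnj (x + y) = rcnj x + rcnj y"
    and rcnj_mult: "rcnj (x * y) = rcnj x * rcnj y"
    and mult_rcnj_scaleR: "x * rcnj x = (norm x)\<^sup>2 *\<^sub>R 1"

instantiation real :: rc_field
begin
definition rcnj_real :: "real \<Rightarrow> real" where "rcnj_real x = x"
instance by standard (simp_all add: rcnj_real_def power2_eq_square)
end

instantiation complex :: rc_field
begin
definition rcnj_complex :: "complex \<Rightarrow> complex" where "rcnj_complex = cnj"
instance
  by standard (simp_all add: rcnj_complex_def scaleR_conv_of_real flip: complex_norm_square)
end

lemma mult_rcnj: "x * rcnj x = of_real ((norm (x::'a::rc_field))\<^sup>2)"
  by (simp add: mult_rcnj_scaleR scaleR_conv_of_real)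

lemma rcnj_0 [simp]: "rcnj (0::'a::rc_field) = 0"
  using rcnj_add[of "0::'a" 0] by simp

lemma rcnj_minus [simp]: "rcnj (- x) = - rcnj (x::'a::rc_field)"
  using rcnj_add[of x "- x"] by (simp add: minus_unique)

lemma rcnj_diff: "rcnj (x - y) = rcnj x - rcnj (y::'a::rc_field)"
  using rcnj_add[of x "- y"] by simp

lemma norm_rcnj [simp]: "norm (rcnj x) = norm (x::'a::rc_field)"
proof (cases "x = 0")
  case False
  have "norm x * norm (rcnj x) = norm x * norm x"
    using arg_cong[OF mult_rcnj[of x], of norm] by (simp add: norm_mult power2_eq_square)
  then show ?thesis using False by simp
qed simp

lemma rcnj_rcnj [simp]: "rcnj (rcnj x) = (x::'a::rc_field)"
proof (cases "x = 0")
  case False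
  then have "rcnj x \<noteq> 0" by (metis norm_eq_zero norm_rcnj)
  moreover have "rcnj x * rcnj (rcnj x) = rcnj x * x"
    by (simp add: mult_rcnj mult.commute[of _ x])
  ultimately show ?thesis by simp
qed simp

lemma rcnj_of_real [simp]: "rcnj (of_real r) = (of_real r :: 'a::rc_field)"
proof (cases "r = 0")
  case False
  have "of_real r * rcnj (of_real r :: 'a) = of_real r * of_real r"
    by (simp add: mult_rcnj flip: of_real_mult) (simp add: power2_eq_square)
  then show ?thesis using False by simp
qed simp

lemma rcnj_sum: "rcnj (sum f A) = (\<Sum>i\<in>A. rcnj (f i :: 'a::rc_field))"
  by (induction A rule: infinite_finite_induct) (simp_all add: rcnj_add)

lemma add_rcnj_Reals: "z + rcnj z \<in> (\<real> :: 'a::rc_field set)"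
proof -
  have "rcnj 1 = (1::'a)" using rcnj_of_real[of 1, where 'a='a] by simp
  then have "(z + 1) * rcnj (z + 1) = z * rcnj z + (z + rcnj z) + 1"
    by (simp add: rcnj_add algebra_simps)
  then have "z + rcnj z = of_real ((norm (z + 1))\<^sup>2) - of_real ((norm z)\<^sup>2) - 1"
    unfolding mult_rcnj by (simp add: algebra_simps)
  then show ?thesis by (simp del: of_real_power)
qed

lemma Reals_if_rcnj_eq: "z \<in> (\<real> :: 'a::rc_field set)" if "rcnj z = z"
proof -
  have "2 * z \<in> \<real>" using add_rcnj_Reals[of z] that by (simp only: mult_2)
  then have "2 * z / 2 \<in> \<real>" by (intro Reals_divide) auto
  then show ?thesis by simp
qed

lemma rc_field_cases:
  obtains (real) "\<And>z::'a::rc_field. z \<in> \<real> \<and> rcnj z = z"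
  | (complex) i :: "'a::rc_field" where "i * i = -1" "rcnj i = - i"
      "\<And>z. \<exists>a b. z = of_real a + of_real b * i" "\<And>a b. norm (of_real a + of_real b * i) = sqrt (a\<^sup>2 + b\<^sup>2)"
proof (cases "\<forall>z::'a. rcnj z = z")
  case True
  then show ?thesis using real Reals_if_rcnj_eq by blast
next
  case False
  then obtain w :: 'a where w: "rcnj w \<noteq> w" by blast
  define s where "s = w - rcnj w"
  have s0: "s \<noteq> 0" using w by (simp add: s_def)
  have cs: "rcnj s = - s" by (simp add: s_def rcnj_diff)
  define i where "i = of_real (inverse (norm s)) * s"
  have ci: "rcnj i = - i" by (simp add: i_def rcnj_mult cs flip: of_real_inverse)
  have "norm i = 1" using s0 by (simp add: i_def norm_mult norm_inverse)
  then have ii: "i * i = -1" using mult_rcnj[of i] ci by (simp add: minus_equation_iff)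
  show ?thesis
  proof (rule complex[OF ii ci])
    fix z :: 'a
    have h: "x / 2 \<in> \<real>" if "x \<in> \<real>" for x :: 'a using that by (intro Reals_divide) auto
    obtain a where a: "(z + rcnj z) / 2 = of_real a"
      using h[OF add_rcnj_Reals[of z]] by (meson Reals_cases)
    have "rcnj ((z - rcnj z) * i) = (z - rcnj z) * i" by (simp add: rcnj_mult rcnj_diff ci algebra_simps)
    from h[OF Reals_if_rcnj_eq[OF this]] obtain b where b: "(z - rcnj z) * i / 2 = of_real b"
      by (meson Reals_cases)
    have "of_real (- b) * i = - ((z - rcnj z) * (i * i) / 2)" unfolding of_real_minus b[symmetric] by simp
    also have "\<dots> = (z - rcnj z) / 2" unfolding ii by (simp only: mult_minus_right mult_1_right minus_divide_left minus_minus)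
    finally have "of_real a + of_real (- b) * i = ((z + rcnj z) + (z - rcnj z)) / 2"
      unfolding a[symmetric] by (simp only: add_divide_distrib)
    also have "\<dots> = (2 * z) / 2" by (simp only: mult_2) simp
    finally have "z = of_real a + of_real (- b) * i" by simp
    then show "\<exists>a b. z = of_real a + of_real b * i" by metis
  next
    fix a b
    let ?z = "of_real a + of_real b * i"
    have "of_real ((norm ?z)\<^sup>2) = ?z * rcnj ?z" by (simp only: mult_rcnj)
    also have "\<dots> = of_real a * of_real a - of_real b * of_real b * (i * i)"
      by (simp add: rcnj_add rcnj_mult ci algebra_simps)
    also have "\<dots> = of_real (a\<^sup>2 + b\<^sup>2)" by (simp add: ii power2_eq_square)
    finally have "(norm ?z)\<^sup>2 = a\<^sup>2 + b\<^sup>2" unfolding of_real_eq_iff .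
    then show "norm ?z = sqrt (a\<^sup>2 + b\<^sup>2)" by (metis norm_ge_zero real_sqrt_unique)
  qed
qed

lemma l2_add_aux:
  fixes f g :: "nat \<Rightarrow> 'a::real_normed_vector"
  assumes f: "summable (\<lambda>n. (norm (f n))\<^sup>2)" and g: "summable (\<lambda>n. (norm (g n))\<^sup>2)"
  shows "summable (\<lambda>n. (norm (f n + g n))\<^sup>2)"
    and "sqrt (\<Sum>n. (norm (f n + g n))\<^sup>2) \<le> sqrt (\<Sum>n. (norm (f n))\<^sup>2) + sqrt (\<Sum>n. (norm (g n))\<^sup>2)"
proof -
  let ?C = "sqrt (\<Sum>n. (norm (f n))\<^sup>2) + sqrt (\<Sum>n. (norm (g n))\<^sup>2)"
  have C0: "?C \<ge> 0" by (simp add: suminf_nonneg f g)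
  have b: "(\<Sum>n<N. (norm (f n + g n))\<^sup>2) \<le> ?C\<^sup>2" for N
  proof -
    have "L2_set (\<lambda>n. norm (f n + g n)) {..<N} \<le> L2_set (\<lambda>n. norm (f n) + norm (g n)) {..<N}"
      by (intro L2_set_mono norm_triangle_ineq norm_ge_zero)
    also have "\<dots> \<le> L2_set (\<lambda>n. norm (f n)) {..<N} + L2_set (\<lambda>n. norm (g n)) {..<N}"
      by (rule L2_set_triangle_ineq)
    also have "\<dots> \<le> ?C"
      unfolding L2_set_def by (intro add_mono real_sqrt_le_mono sum_le_suminf f g) auto
    finally have "(L2_set (\<lambda>n. norm (f n + g n)) {..<N})\<^sup>2 \<le> ?C\<^sup>2"
      by (intro power_mono) auto
    then show ?thesis by (simp add: L2_set_def sum_nonneg)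
  qed
  show s: "summable (\<lambda>n. (norm (f n + g n))\<^sup>2)"
    by (rule summableI_nonneg_bounded[where x = "?C\<^sup>2"]) (auto simp: b)
  show "sqrt (\<Sum>n. (norm (f n + g n))\<^sup>2) \<le> ?C"
    using C0 suminf_le_const[OF s b] by (simp add: real_le_lsqrt)
qed

typedef (overloaded) 'a ell2 = "{f :: nat \<Rightarrow> 'a::real_normed_vector. summable (\<lambda>n. (norm (f n))\<^sup>2)}"
  morphisms ell2_nth Abs_ell2
  by (rule exI[of _ "\<lambda>_. 0"]) simp

setup_lifting type_definition_ell2

lemma ell2_summable: "summable (\<lambda>n. (norm (ell2_nth x n))\<^sup>2)"
  using ell2_nth[of x] by simp

lemma ell2_eqI: "(\<And>n. ell2_nth x n = ell2_nth y n) \<Longrightarrow> x = y"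
  by (metis ell2_nth_inject ext)

instantiation ell2 :: (real_normed_vector) real_normed_vector
begin

lift_definition zero_ell2 :: "'a ell2" is "\<lambda>_. 0" by simp
lift_definition plus_ell2 :: "'a ell2 \<Rightarrow> 'a ell2 \<Rightarrow> 'a ell2" is "\<lambda>f g n. f n + g n"
  by (rule l2_add_aux)
lift_definition uminus_ell2 :: "'a ell2 \<Rightarrow> 'a ell2" is "\<lambda>f n. - f n" by simp
lift_definition minus_ell2 :: "'a ell2 \<Rightarrow> 'a ell2 \<Rightarrow> 'a ell2" is "\<lambda>f g n. f n - g n"
  subgoal for f g using l2_add_aux(1)[of f "\<lambda>n. - g n"] by simp done
lift_definition scaleR_ell2 :: "real \<Rightarrow> 'a ell2 \<Rightarrow> 'a ell2" is "\<lambda>r f n. r *\<^sub>R f n"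
  by (simp add: power_mult_distrib summable_mult)
lift_definition norm_ell2 :: "'a ell2 \<Rightarrow> real" is "\<lambda>f. sqrt (\<Sum>n. (norm (f n))\<^sup>2)" .
definition dist_ell2 :: "'a ell2 \<Rightarrow> 'a ell2 \<Rightarrow> real" where "dist_ell2 x y = norm (x - y)"
definition sgn_ell2 :: "'a ell2 \<Rightarrow> 'a ell2" where "sgn_ell2 x = inverse (norm x) *\<^sub>R x"
definition uniformity_ell2 :: "('a ell2 \<times> 'a ell2) filter" where
  "uniformity_ell2 = (INF e\<in>{0<..}. principal {(x, y). dist x y < e})"
definition open_ell2 :: "'a ell2 set \<Rightarrow> bool" where
  "open_ell2 U = (\<forall>x\<in>U. eventually (\<lambda>(x', y). x' = x \<longrightarrow> y \<in> U) uniformity)"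

instance
proof
  fix x y z :: "'a ell2" and a b :: real
  show "x + y + z = x + (y + z)" by transfer (simp add: add.assoc)
  show "x + y = y + x" by transfer (simp add: add.commute)
  show "0 + x = x" by transfer simp
  show "- x + x = 0" by transfer simp
  show "x - y = x + - y" by transfer simp
  show "a *\<^sub>R (x + y) = a *\<^sub>R x + a *\<^sub>R y" by transfer (simp add: scaleR_add_right)
  show "(a + b) *\<^sub>R x = a *\<^sub>R x + b *\<^sub>R x" by transfer (simp add: scaleR_add_left)
  show "a *\<^sub>R b *\<^sub>R x = (a * b) *\<^sub>R x" by transfer simp
  show "1 *\<^sub>R x = x" by transfer simp
  show "dist x y = norm (x - y)" by (rule dist_ell2_def)
  show "sgn x = inverse (norm x) *\<^sub>R x" by (simp add: sgn_ell2_def)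
  show "uniformity = (INF e\<in>{0<..}. principal {(x, y :: 'a ell2). dist x y < e})"
    by (rule uniformity_ell2_def)
  show "open U = (\<forall>x\<in>U. eventually (\<lambda>(x', y). x' = x \<longrightarrow> y \<in> U) uniformity)" for U :: "'a ell2 set"
    by (rule open_ell2_def)
  show "(norm x = 0) = (x = 0)" by transfer (simp add: suminf_eq_zero_iff fun_eq_iff)
  show "norm (x + y) \<le> norm x + norm y" by transfer (simp add: l2_add_aux)
  show "norm (a *\<^sub>R x) = \<bar>a\<bar> * norm x"
    by transfer (simp add: power_mult_distrib suminf_mult real_sqrt_mult)
qed

end

lift_definition ell2_scale :: "'k::real_normed_field \<Rightarrow> 'k ell2 \<Rightarrow> 'k ell2" is "\<lambda>c f n. c * f n"
  by (simp add: norm_mult power_mult_distrib summable_mult)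

lift_definition ell2_unit :: "nat \<Rightarrow> 'k::real_normed_field ell2" is "\<lambda>m n. if n = m then 1 else 0"
proof -
  fix m :: nat
  show "summable (\<lambda>n. (norm (if n = m then 1 else 0 :: 'k))\<^sup>2)"
    by (rule summable_finite[of "{m}"]) auto
qed

definition ell2_inner :: "'k::rc_field ell2 \<Rightarrow> 'k ell2 \<Rightarrow> 'k" where
  "ell2_inner x y = (\<Sum>n. ell2_nth x n * rcnj (ell2_nth y n))"

lemma ell2_nth_add [simp]: "ell2_nth (x + y) n = ell2_nth x n + ell2_nth y n"
  by transfer simp

lemma ell2_nth_scaleR [simp]: "ell2_nth (r *\<^sub>R x) n = r *\<^sub>R ell2_nth x n"
  by transfer simp

lemma ell2_nth_scale [simp]: "ell2_nth (ell2_scale c x) n = c * ell2_nth x n"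
  by transfer simp

lemma ell2_nth_diff [simp]: "ell2_nth (x - y) n = ell2_nth x n - ell2_nth y n"
  by transfer simp

lemma ell2_nth_0 [simp]: "ell2_nth 0 n = 0"
  by transfer simp

lemma ell2_nth_unit [simp]: "ell2_nth (ell2_unit m) n = (if n = m then 1 else 0)"
  by transfer simp

lemma ell2_nth_sum [simp]: "ell2_nth (sum f A) n = (\<Sum>i\<in>A. ell2_nth (f i) n)"
  by (induction A rule: infinite_finite_induct) simp_all

lemma norm_ell2_sq: "(norm x)\<^sup>2 = (\<Sum>n. (norm (ell2_nth x n))\<^sup>2)"
  by transfer (simp add: suminf_nonneg)

lemma L2_set_le_norm_ell2: "finite A \<Longrightarrow> L2_set (\<lambda>n. norm (ell2_nth x n)) A \<le> norm x"
  unfolding L2_set_def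
  by (intro real_le_lsqrt) (auto simp: norm_ell2_sq intro!: sum_le_suminf ell2_summable sum_nonneg)

lemma ell2_inner_bounds:
  fixes x y :: "'k::rc_field ell2"
  shows summable_ell2_inner_norm: "summable (\<lambda>n. norm (ell2_nth x n * rcnj (ell2_nth y n)))"
    and norm_ell2_inner_le: "norm (ell2_inner x y) \<le> norm x * norm y"
proof -
  have b: "(\<Sum>n<N. norm (ell2_nth x n * rcnj (ell2_nth y n))) \<le> norm x * norm y" for N
  proof -
    have "(\<Sum>n<N. norm (ell2_nth x n * rcnj (ell2_nth y n)))
        = (\<Sum>n<N. \<bar>norm (ell2_nth x n)\<bar> * \<bar>norm (ell2_nth y n)\<bar>)"
      by (simp add: norm_mult)
    also have "\<dots> \<le> L2_set (\<lambda>n. norm (ell2_nth x n)) {..<N} * L2_set (\<lambda>n. norm (ell2_nth y n)) {..<N}"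
      by (rule L2_set_mult_ineq)
    also have "\<dots> \<le> norm x * norm y"
      by (intro mult_mono L2_set_le_norm_ell2) auto
    finally show ?thesis .
  qed
  show s: "summable (\<lambda>n. norm (ell2_nth x n * rcnj (ell2_nth y n)))"
    by (rule summableI_nonneg_bounded[where x = "norm x * norm y"]) (auto simp only: b norm_ge_zero)
  show "norm (ell2_inner x y) \<le> norm x * norm y"
    unfolding ell2_inner_def using summable_norm[OF s] suminf_le_const[OF s b] by linarith
qed

lemmas summable_ell2_inner = summable_norm_cancel[OF summable_ell2_inner_norm]

lemma ell2_inner_add_left: "ell2_inner (x + y) z = ell2_inner x z + ell2_inner y z"
  by (simp add: ell2_inner_def distrib_right suminf_add summable_ell2_inner)

lemma ell2_inner_add_right: "ell2_inner x (y + z) = ell2_inner x y + ell2_inner x z"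
  by (simp add: ell2_inner_def rcnj_add distrib_left suminf_add summable_ell2_inner)

lemma ell2_inner_scale_left: "ell2_inner (ell2_scale c x) y = c * ell2_inner x y"
  by (simp add: ell2_inner_def mult.assoc suminf_mult summable_ell2_inner)

lemma ell2_inner_scale_right: "ell2_inner x (ell2_scale c y) = rcnj c * ell2_inner x y"
  by (simp add: ell2_inner_def rcnj_mult mult.left_commute suminf_mult summable_ell2_inner)

lemma scaleR_eq_ell2_scale: "r *\<^sub>R x = ell2_scale (of_real r) (x :: 'k::rc_field ell2)"
  by (rule ell2_eqI) (simp add: scaleR_conv_of_real)

lemma bounded_bilinear_ell2_inner: "bounded_bilinear (ell2_inner :: 'k::rc_field ell2 \<Rightarrow> _)"
proof (rule bounded_bilinear.intro)
  show "\<exists>K. \<forall>a b :: 'k ell2. norm (ell2_inner a b) \<le> norm a * norm b * K"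
    by (rule exI[of _ 1]) (simp add: norm_ell2_inner_le)
qed (simp_all add: ell2_inner_add_left ell2_inner_add_right scaleR_eq_ell2_scale
    ell2_inner_scale_left ell2_inner_scale_right scaleR_conv_of_real)

interpretation ell2_inner: bounded_bilinear "ell2_inner :: 'k::rc_field ell2 \<Rightarrow> 'k ell2 \<Rightarrow> 'k"
  by (rule bounded_bilinear_ell2_inner)

lemma ell2_inner_self: "ell2_inner x x = of_real ((norm x)\<^sup>2)"
proof -
  have "(\<lambda>n. of_real ((norm (ell2_nth x n))\<^sup>2)) sums (of_real ((norm x)\<^sup>2) :: 'a)"
    unfolding norm_ell2_sq by (intro sums_of_real summable_sums ell2_summable)
  then show ?thesis by (simp only: ell2_inner_def mult_rcnj sums_unique[symmetric])
qed

lemma ell2_inner_commute: "ell2_inner y x = rcnj (ell2_inner x y)"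
proof -
  have "bounded_linear (rcnj :: 'a \<Rightarrow> 'a)"
    by (rule bounded_linear_intro[where K = 1])
      (simp_all add: rcnj_add rcnj_mult scaleR_conv_of_real)
  then have "rcnj (ell2_inner x y) = (\<Sum>n. rcnj (ell2_nth x n * rcnj (ell2_nth y n)))"
    unfolding ell2_inner_def by (rule bounded_linear.suminf) (rule summable_ell2_inner)
  then show ?thesis by (simp add: ell2_inner_def rcnj_mult mult.commute)
qed

lemma ell2_inner_unit_right [simp]: "ell2_inner x (ell2_unit n) = ell2_nth x n"
proof -
  have "rcnj 1 = (1::'a)" using rcnj_of_real[of 1, where 'a='a] by simp
  then have "ell2_inner x (ell2_unit n) = (\<Sum>m. if m = n then ell2_nth x m else 0)"
    unfolding ell2_inner_def by (intro arg_cong[of _ _ suminf] ext) simp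
  also have "\<dots> = (\<Sum>m\<in>{n}. if m = n then ell2_nth x m else 0)"
    by (rule suminf_finite) auto
  finally show ?thesis by simp
qed

lemma ell2_inner_unit_left [simp]: "ell2_inner (ell2_unit n) x = rcnj (ell2_nth x n)"
  by (subst ell2_inner_commute) simp

lemma ell2_eqI_inner: "(\<And>x. ell2_inner x y = ell2_inner x z) \<Longrightarrow> y = z"
  by (rule ell2_eqI) (metis ell2_inner_unit_left rcnj_rcnj)

lemma ell2_truncate_LIMSEQ:
  fixes x :: "'k::rc_field ell2"
  shows "(\<lambda>N. \<Sum>n<N. ell2_scale (ell2_nth x n) (ell2_unit n)) \<longlonglongrightarrow> x"
proof -
  let ?t = "\<lambda>N. \<Sum>n<N. ell2_scale (ell2_nth x n) (ell2_unit n)"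
  let ?a = "\<lambda>n. (norm (ell2_nth x n))\<^sup>2"
  have nth: "ell2_nth (?t N) n = (if n < N then ell2_nth x n else 0)" for N n
    by (simp add: sum.delta' if_distrib[of "\<lambda>c. _ * c"] cong: if_cong)
  have "(norm (x - ?t N))\<^sup>2 = (norm x)\<^sup>2 - (\<Sum>n<N. ?a n)" for N
  proof -
    have "(\<lambda>n. if n < N then ?a n else 0) sums (\<Sum>n<N. ?a n)"
      using sums_If_finite_set[of "{..<N}" ?a] by simp
    then have "(\<lambda>n. ?a n - (if n < N then ?a n else 0)) sums ((norm x)\<^sup>2 - (\<Sum>n<N. ?a n))"
      unfolding norm_ell2_sq by (intro sums_diff summable_sums ell2_summable)
    moreover have "?a n - (if n < N then ?a n else 0) = (norm (ell2_nth (x - ?t N) n))\<^sup>2" for n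
      unfolding ell2_nth_diff nth by simp
    ultimately show ?thesis unfolding norm_ell2_sq[of "x - ?t N"] by (simp add: sums_iff)
  qed
  moreover have "(\<lambda>N. (norm x)\<^sup>2 - (\<Sum>n<N. ?a n)) \<longlonglongrightarrow> (norm x)\<^sup>2 - (norm x)\<^sup>2"
    unfolding norm_ell2_sq by (intro tendsto_diff tendsto_const summable_LIMSEQ ell2_summable)
  ultimately have "(\<lambda>N. (norm (x - ?t N))\<^sup>2) \<longlonglongrightarrow> 0" by simp
  then have "(\<lambda>N. norm (x - ?t N)) \<longlonglongrightarrow> 0"
    using tendsto_real_sqrt[of "\<lambda>N. (norm (x - ?t N))\<^sup>2" 0] by simp
  then show ?thesis by (simp add: LIMSEQ_iff norm_minus_commute)
qed

text \<open>
  Elements of \<open>'k ell2 \<Rightarrow>\<^sub>L 'k ell2\<close> are only bounded and \<^emph>\<open>real\<close>-linear; the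
  bounded operators over \<open>'k\<close> are those that moreover commute with all scalars of \<open>'k\<close>.
\<close>

definition scalar_linear :: "('k::rc_field ell2 \<Rightarrow>\<^sub>L 'k ell2) \<Rightarrow> bool" where
  "scalar_linear T \<longleftrightarrow> (\<forall>c x. T (ell2_scale c x) = ell2_scale c (T x))"

definition adj :: "('k::rc_field ell2 \<Rightarrow>\<^sub>L 'k ell2) \<Rightarrow> ('k ell2 \<Rightarrow>\<^sub>L 'k ell2)" where
  "adj T = (THE T'. \<forall>x y. ell2_inner (T x) y = ell2_inner x (blinfun_apply T' y))"

lemma adj_unique:
  assumes "\<And>x y. ell2_inner (blinfun_apply T x) y = ell2_inner x (blinfun_apply T' y)"
  shows "adj T = T'"
  unfolding adj_def using assms
  by (intro the_equality) (auto intro!: blinfun_eqI ell2_eqI_inner)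

lemma adj_exists:
  fixes T :: "'k::rc_field ell2 \<Rightarrow>\<^sub>L 'k ell2"
  assumes T: "scalar_linear T"
  shows "\<exists>T'. \<forall>x y. ell2_inner (T x) y = ell2_inner x (blinfun_apply T' y)"
proof -
  define a where "a y n = ell2_inner y (T (ell2_unit n))" for y n
  have T_scale: "T (ell2_scale c x) = ell2_scale c (T x)" for c x
    using T by (simp add: scalar_linear_def)
  have bound: "(\<Sum>n<N. (norm (a y n))\<^sup>2) \<le> (norm y * norm T)\<^sup>2" for y N
  proof -
    define v where "v = (\<Sum>n<N. ell2_scale (a y n) (ell2_unit n))"
    let ?s = "\<Sum>n<N. (norm (a y n))\<^sup>2"
    have nth: "ell2_nth v n = (if n < N then a y n else 0)" for n
      by (simp add: v_def sum.delta' if_distrib[of "\<lambda>c. _ * c"] cong: if_cong)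
    have "(norm v)\<^sup>2 = (\<Sum>n. if n < N then (norm (a y n))\<^sup>2 else 0)"
      unfolding norm_ell2_sq nth by (intro arg_cong[of _ _ suminf] ext) simp
    also have "\<dots> = ?s"
      using sums_If_finite_set[of "{..<N}" "\<lambda>n. (norm (a y n))\<^sup>2"] by (simp add: sums_iff)
    finally have nv: "(norm v)\<^sup>2 = ?s" .
    have "ell2_inner y (T v) = (\<Sum>n<N. rcnj (a y n) * a y n)"
      by (simp add: v_def blinfun.sum_right T_scale ell2_inner.sum_right ell2_inner_scale_right a_def)
    also have "\<dots> = of_real ?s"
      unfolding of_real_sum by (intro sum.cong refl) (metis mult.commute mult_rcnj)
    finally have "norm (ell2_inner y (T v)) = ?s" by (simp add: sum_nonneg del: of_real_sum)
    moreover have "norm (ell2_inner y (T v)) \<le> norm y * (norm T * norm v)"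
      using norm_ell2_inner_le[of y "T v"] mult_left_mono[OF norm_blinfun[of T v], of "norm y"] by simp
    ultimately have "norm v * norm v \<le> (norm y * norm T) * norm v"
      using nv by (simp add: power2_eq_square mult.assoc)
    then have "norm v \<le> norm y * norm T"
      by (cases "norm v = 0") auto
    then show ?thesis using power_mono[of "norm v" _ 2] nv by simp
  qed
  have summ: "summable (\<lambda>n. (norm (a y n))\<^sup>2)" for y
    by (rule summableI_nonneg_bounded[where x = "(norm y * norm T)\<^sup>2"]) (auto simp: bound)
  define A where "A y = Abs_ell2 (a y)" for y
  have nthA: "ell2_nth (A y) n = a y n" for y n
    using summ by (simp add: A_def Abs_ell2_inverse)
  have "bounded_linear A"
  proof (rule bounded_linear_intro[where K = "norm T"])
    show "A (x + y) = A x + A y" for x y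
      by (rule ell2_eqI) (simp add: nthA a_def ell2_inner.add_left)
    show "A (r *\<^sub>R x) = r *\<^sub>R A x" for r x
      by (rule ell2_eqI) (simp add: nthA a_def ell2_inner.scaleR_left)
    show "norm (A y) \<le> norm y * norm T" for y
    proof (rule power2_le_imp_le)
      show "(norm (A y))\<^sup>2 \<le> (norm y * norm T)\<^sup>2"
        unfolding norm_ell2_sq nthA by (rule suminf_le_const[OF summ bound])
    qed simp
  qed
  then have A: "blinfun_apply (Blinfun A) = A" by (rule bounded_linear_Blinfun_apply)
  have "ell2_inner (T x) y = ell2_inner x (A y)" for x y
  proof -
    let ?t = "\<lambda>N. \<Sum>n<N. ell2_scale (ell2_nth x n) (ell2_unit n)"
    have "ell2_inner (T (?t N)) y = ell2_inner (?t N) (A y)" for N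
      by (simp add: blinfun.sum_right T_scale ell2_inner.sum_left ell2_inner_scale_left nthA a_def
          ell2_inner_commute[of "T _" y])
    moreover have "(\<lambda>N. ell2_inner (T (?t N)) y) \<longlonglongrightarrow> ell2_inner (T x) y"
      by (intro ell2_inner.tendsto blinfun.tendsto tendsto_const ell2_truncate_LIMSEQ)
    moreover have "(\<lambda>N. ell2_inner (?t N) (A y)) \<longlonglongrightarrow> ell2_inner x (A y)"
      by (intro ell2_inner.tendsto tendsto_const ell2_truncate_LIMSEQ)
    ultimately show ?thesis using LIMSEQ_unique by simp
  qed
  then show ?thesis using A by metis
qed

lemma adj_works:
  assumes "scalar_linear T"
  shows "ell2_inner (T x) y = ell2_inner x (adj T y)"
  using adj_exists[OF assms] adj_unique by metis

lemma scalar_linear_adj: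
  assumes "scalar_linear T"
  shows "scalar_linear (adj T)"
  unfolding scalar_linear_def
  by (auto intro!: ell2_eqI_inner simp: ell2_inner_scale_right simp flip: adj_works[OF assms])

definition self_adjoint_collection :: "('k::rc_field ell2 \<Rightarrow>\<^sub>L 'k ell2) set \<Rightarrow> bool" where
  "self_adjoint_collection C \<longleftrightarrow> (\<forall>T\<in>C. adj T \<in> C)"

definition operator_semigroup :: "('k::rc_field ell2 \<Rightarrow>\<^sub>L 'k ell2) set \<Rightarrow> bool" where
  "operator_semigroup C \<longleftrightarrow> (\<forall>T\<in>C. scalar_linear T) \<and> (\<forall>S\<in>C. \<forall>T\<in>C. S o\<^sub>L T \<in> C)"

definition projection :: "('k::rc_field ell2 \<Rightarrow>\<^sub>L 'k ell2) \<Rightarrow> bool" where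
  "projection P \<longleftrightarrow> scalar_linear P \<and> adj P = P \<and> P o\<^sub>L P = P"

definition positive_operator :: "('k::rc_field ell2 \<Rightarrow>\<^sub>L 'k ell2) \<Rightarrow> bool" where
  "positive_operator B \<longleftrightarrow>
     scalar_linear B \<and> adj B = B \<and> (\<forall>x. ell2_inner (B x) x \<in> \<real>\<^sub>\<ge>\<^sub>0)"

text \<open>
  An operator is trace class if its absolute value \<open>B\<close>, the unique positive square root
  of \<open>adj T o\<^sub>L T\<close>, has a finite trace. For positive operators and for trace-class operators the
  (possibly infinite, respectively absolutely convergent) sum of the diagonal entries does not
  depend on the orthonormal basis, so the standard basis is used.
\<close>

definition trace_class :: "('k::rc_field ell2 \<Rightarrow>\<^sub>L 'k ell2) \<Rightarrow> bool" where
  "trace_class T \<longleftrightarrow> scalar_linear T \<and>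
     (\<exists>B. positive_operator B \<and> B o\<^sub>L B = adj T o\<^sub>L T \<and>
          summable (\<lambda>n. ell2_inner (B (ell2_unit n)) (ell2_unit n)))"

definition op_trace :: "('k::rc_field ell2 \<Rightarrow>\<^sub>L 'k ell2) \<Rightarrow> 'k" where
  "op_trace T = (\<Sum>n. ell2_inner (T (ell2_unit n)) (ell2_unit n))"

end

theory Submission
  imports Defs
begin

text \<open>
  For \<open>A \<in> \<S>\<close> put \<open>K = A\<^sup>*A\<close>. The sequence \<open>c j = tr K\<^bsup>2j\<^esup>\<close> is the squared Hilbert-Schmidt norm of
  \<open>K\<^sup>j\<close>, takes finitely many values, and has second differences equal to the squared Hilbert-Schmidt
  norm of \<open>K\<^bsup>j+2\<^esup> - K\<^sup>j\<close>. The first differences increase and take finitely many values, so some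
  second difference vanishes; as \<open>K\<close> is positive, this forces \<open>K\<^sup>2 = K\<close>. Hence every \<open>A \<in> \<S>\<close> satisfies
  \<open>A = Q A P\<close> with the projections \<open>P = A\<^sup>*A\<close> and \<open>Q = A A\<^sup>*\<close> in \<open>\<S>\<close>, which have finite rank. The
  operators with prescribed \<open>P\<close> and \<open>Q\<close> span a finite-dimensional space, so finitely many functionals
  \<open>X \<mapsto> tr (C\<^sup>*X)\<close> with \<open>C \<in> \<S>\<close> separate them, and each of these takes finitely many values on \<open>\<S>\<close>.
\<close>

section \<open>Finiteness tools: convex sequences and spanning families\<close>

text \<open>Convexity makes the first differences nondecreasing; as they take finitely many values,
  they cannot grow further at an index where they are maximal.\<close>

lemma second_difference_eq_0:
  fixes c :: "nat \<Rightarrow> real"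
  assumes fin: "finite (range c)" and cvx: "\<And>j. c (j + 2) - 2 * c (j + 1) + c j \<ge> 0"
  shows "\<exists>j. c (j + 2) - 2 * c (j + 1) + c j = 0"
proof -
  define d where "d j = c (j + 1) - c j" for j
  have "range d \<subseteq> (\<lambda>(x, y). x - y) ` (range c \<times> range c)"
    by (auto simp: d_def image_iff)
  then have fd: "finite (range d)"
    using fin by (meson finite_SigmaI finite_imageI finite_subset)
  then have "Max (range d) \<in> range d" by (intro Max_in) auto
  then obtain j where j: "d j = Max (range d)" by auto
  have "d (j + 1) \<le> d j" unfolding j using fd by (intro Max_ge) auto
  then have "c (j + 2) - 2 * c (j + 1) + c j \<le> 0" by (simp add: d_def)
  with cvx[of j] show ?thesis by (intro exI[of _ j]) linarith
qed

text \<open>Gaussian elimination, one coordinate of \<open>J\<close> per induction step.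
  \<open>F\<close> may be infinite; choosing \<open>G\<close> inside \<open>F\<close> lets
  \<open>finite_fibre\<close> test operators against members of the family itself.\<close>

lemma finite_spanning_subset:
  fixes v :: "'a \<Rightarrow> 'j \<Rightarrow> 'k::field"
  assumes "finite J"
  shows "\<exists>G\<subseteq>F. finite G \<and> (\<forall>a\<in>F. \<exists>c. \<forall>j\<in>J. v a j = (\<Sum>b\<in>G. c b * v b j))"
  using assms
proof (induction J arbitrary: v)
  case empty
  show ?case by (intro exI[of _ "{}"]) auto
next
  case (insert i J)
  show ?case
  proof (cases "\<forall>a\<in>F. v a i = 0")
    case True
    from insert.IH[of v] obtain G where G: "G \<subseteq> F" "finite G"
      and c: "\<forall>a\<in>F. \<exists>c. \<forall>j\<in>J. v a j = (\<Sum>b\<in>G. c b * v b j)" by blast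
    have "\<exists>c. \<forall>j\<in>insert i J. v a j = (\<Sum>b\<in>G. c b * v b j)" if "a \<in> F" for a
    proof -
      have "(\<Sum>b\<in>G. f b * v b i) = 0" for f
        using True G by (intro sum.neutral) auto
      with c that True show ?thesis by (metis insert_iff)
    qed
    with G show ?thesis by blast
  next
    case False
    then obtain a0 where a0: "a0 \<in> F" "v a0 i \<noteq> 0" by blast
    \<comment> \<open>Elimination with pivot \<open>a0\<close>: coordinate \<open>i\<close> of every
      \<open>w a\<close> vanishes.\<close>
    define w where "w a j = v a j - v a i / v a0 i * v a0 j" for a j
    from insert.IH[of w] obtain G where G: "G \<subseteq> F" "finite G"
      and c: "\<forall>a\<in>F. \<exists>c. \<forall>j\<in>J. w a j = (\<Sum>b\<in>G. c b * w b j)" by blast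
    have "\<exists>c. \<forall>j\<in>insert i J. v a j = (\<Sum>b\<in>insert a0 G. c b * v b j)" if "a \<in> F" for a
    proof -
      obtain c where c: "\<forall>j\<in>J. w a j = (\<Sum>b\<in>G. c b * w b j)" using c \<open>a \<in> F\<close> by blast
      have wi: "w b i = 0" for b using a0 by (simp add: w_def)
      have w: "w a j = (\<Sum>b\<in>G. c b * w b j)" if "j \<in> insert i J" for j
        using c that by (auto simp: wi)
      \<comment> \<open>\<open>s\<close> collects the multiples of \<open>v a0\<close> split off by
        \<open>w\<close>. Since \<open>a0\<close> may already belong to \<open>G\<close>,
        \<open>c'\<close> adds \<open>s\<close> to a possible old coefficient.\<close>
      define s where "s = v a i / v a0 i - (\<Sum>b\<in>G. c b * (v b i / v a0 i))"
      define c' where "c' b = (if b \<in> G then c b else 0) + (if b = a0 then s else 0)" for b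
      have "v a j = (\<Sum>b\<in>insert a0 G. c' b * v b j)" if "j \<in> insert i J" for j
      proof -
        have "(\<Sum>b\<in>insert a0 G. c' b * v b j)
            = (\<Sum>b\<in>insert a0 G. (if b \<in> G then c b * v b j else 0) + (if b = a0 then s * v b j else 0))"
          by (intro sum.cong) (auto simp: c'_def distrib_right)
        also have "\<dots> = (\<Sum>b\<in>insert a0 G. if b \<in> G then c b * v b j else 0) + s * v a0 j"
          using G by (simp add: sum.distrib)
        also have "(\<Sum>b\<in>insert a0 G. if b \<in> G then c b * v b j else 0) = (\<Sum>b\<in>G. c b * v b j)"
          using G by (intro sum.mono_neutral_cong_right) auto
        also have "(\<Sum>b\<in>G. c b * v b j)
            = (\<Sum>b\<in>G. c b * w b j + c b * (v b i / v a0 i) * v a0 j)"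
          by (intro sum.cong) (auto simp: w_def algebra_simps)
        also have "\<dots> + s * v a0 j = w a j + v a i / v a0 i * v a0 j"
          using w[OF that] by (simp add: s_def sum.distrib sum_distrib_right left_diff_distrib)
        finally show ?thesis by (simp add: w_def)
      qed
      then show ?thesis by blast
    qed
    with G a0 show ?thesis by (intro exI[of _ "insert a0 G"]) auto
  qed
qed

section \<open>Adjoints, Hilbert-Schmidt operators and the trace form\<close>

lemma adj_works':
  assumes "scalar_linear T"
  shows "ell2_inner (adj T x) y = ell2_inner x (T y)"
  by (metis adj_works[OF assms] ell2_inner_commute)

lemma adj_adj: "scalar_linear T \<Longrightarrow> adj (adj T) = T"
  by (intro adj_unique) (rule adj_works')

lemma scalar_linear_eqI:
  fixes S T :: "'k::rc_field ell2 \<Rightarrow>\<^sub>L 'k ell2"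
  assumes "scalar_linear S" "scalar_linear T"
    and eq: "\<And>n. S (ell2_unit n) = T (ell2_unit n)"
  shows "S = T"
proof (rule blinfun_eqI)
  fix x :: "'k ell2"
  let ?t = "\<lambda>N. \<Sum>n<N. ell2_scale (ell2_nth x n) (ell2_unit n)"
  have "S (?t N) = T (?t N)" for N
    using assms(1,2) by (simp add: blinfun.sum_right scalar_linear_def eq)
  moreover have "(\<lambda>N. S (?t N)) \<longlonglongrightarrow> S x" "(\<lambda>N. T (?t N)) \<longlonglongrightarrow> T x"
    by (intro blinfun.tendsto tendsto_const ell2_truncate_LIMSEQ)+
  ultimately show "S x = T x" using LIMSEQ_unique by simp
qed

text \<open>The form in which trace class is used: for two such operators with \<open>C\<close>
  scalar linear, the series for \<open>op_trace (adj C o\<^sub>L A)\<close> converges. Scalar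
  linearity is assumed separately.\<close>

definition hilbert_schmidt :: "('k::rc_field ell2 \<Rightarrow>\<^sub>L 'k ell2) \<Rightarrow> bool" where
  "hilbert_schmidt T \<longleftrightarrow> summable (\<lambda>n. (norm (T (ell2_unit n)))\<^sup>2)"

text \<open>The form inequality B^2 <= m B with m = norm B + 1, obtained without a square root of
  \<open>B\<close>. Positivity at x - (1/m) B x gives q - 2b/m + r/m^2 >= 0, where b = |B x|^2 and r
  = <B B x, B x> <= m b. The summand 1 keeps m positive.\<close>

lemma positive_operator_norm_sq_le:
  assumes B: "positive_operator B"
  obtains q where "ell2_inner (B x) x = of_real q" "(norm (B x))\<^sup>2 \<le> (norm B + 1) * q"
proof -
  have sl: "scalar_linear B" and sa: "adj B = B"
    and pos: "\<And>x. \<exists>r\<ge>0. ell2_inner (B x) x = of_real r"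
    using B by (auto simp: positive_operator_def elim!: nonneg_Reals_cases)
  have sym: "ell2_inner (B x) y = ell2_inner x (B y)" for x y
    using adj_works[OF sl, of x y] sa by simp
  obtain q where q: "ell2_inner (B x) x = of_real q" "q \<ge> 0" using pos by blast
  obtain r where r: "ell2_inner (B (B x)) (B x) = of_real r" "r \<ge> 0" using pos by blast
  let ?b = "(norm (B x))\<^sup>2"
  let ?m = "norm B + 1"
  have m: "?m > 0" by (smt (verit) norm_ge_zero)
  have "r = norm (ell2_inner (B (B x)) (B x))" using r by simp
  also have "\<dots> \<le> norm (B (B x)) * norm (B x)" by (rule norm_ell2_inner_le)
  also have "\<dots> \<le> norm B * norm (B x) * norm (B x)"
    by (intro mult_right_mono norm_blinfun) auto
  also have "\<dots> \<le> ?m * ?b" by (simp add: power2_eq_square algebra_simps)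
  finally have rb: "r \<le> ?m * ?b" .
  let ?u = "x - (1 / ?m) *\<^sub>R B x"
  obtain p where p: "ell2_inner (B ?u) ?u = of_real p" "p \<ge> 0" using pos by blast
  have "ell2_inner (B ?u) ?u = of_real (q - 2 * (1 / ?m) * ?b + (1 / ?m)\<^sup>2 * r)"
  proof -
    have 1: "ell2_inner (B x) (B x) = of_real ?b" by (rule ell2_inner_self)
    have 2: "ell2_inner (B (B x)) x = of_real ?b" using sym[of "B x" x] 1 by simp
    show ?thesis
      unfolding blinfun.diff_right blinfun.scaleR_right ell2_inner.diff_left ell2_inner.diff_right
        ell2_inner.scaleR_left ell2_inner.scaleR_right 1 2 q r scaleR_conv_of_real
      by (simp add: algebra_simps power2_eq_square)
  qed
  with p have "p = q - 2 * (1 / ?m) * ?b + (1 / ?m)\<^sup>2 * r"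
    by (metis of_real_eq_iff)
  also have "(1 / ?m)\<^sup>2 * r \<le> (1 / ?m)\<^sup>2 * (?m * ?b)"
    using rb by (intro mult_left_mono) auto
  also have "\<dots> = (1 / ?m) * ?b" using m by (simp add: power2_eq_square)
  finally have "(1 / ?m) * ?b \<le> q" using p by simp
  then have "?b \<le> ?m * q" using m by (simp add: field_simps)
  with q that show ?thesis by blast
qed

lemma summable_of_realD:
  fixes q :: "nat \<Rightarrow> real"
  assumes "summable (\<lambda>n. of_real (q n) :: 'a::real_normed_field)"
  shows "summable q"
proof -
  have "Cauchy (\<lambda>N. \<Sum>n<N. of_real (q n) :: 'a)"
    using assms by (simp add: summable_iff_convergent convergent_Cauchy)
  then have "Cauchy (\<lambda>N. \<Sum>n<N. q n)"
    unfolding Cauchy_def dist_norm of_real_sum[symmetric] of_real_diff[symmetric] norm_of_real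
      real_norm_def .
  then show ?thesis by (simp add: summable_iff_convergent Cauchy_convergent_iff)
qed

text \<open>\<open>B o\<^sub>L B = adj T o\<^sub>L T\<close> makes |T x| = |B x|, and
  \<open>positive_operator_norm_sq_le\<close> bounds the squared column norms of \<open>B\<close> by
  a multiple of its summable diagonal.\<close>

lemma trace_class_imp_hilbert_schmidt:
  assumes "trace_class T"
  shows "hilbert_schmidt T"
proof -
  from assms obtain B where sl: "scalar_linear T" and B: "positive_operator B"
    and BB: "B o\<^sub>L B = adj T o\<^sub>L T"
    and s: "summable (\<lambda>n. ell2_inner (B (ell2_unit n)) (ell2_unit n))"
    by (auto simp: trace_class_def)
  have slB: "scalar_linear B" and saB: "adj B = B" using B by (auto simp: positive_operator_def)
  have eq: "norm (T x) = norm (B x)" for x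
  proof -
    have "of_real ((norm (T x))\<^sup>2) = ell2_inner ((adj T o\<^sub>L T) x) x"
      by (simp only: ell2_inner_self blinfun_apply_blinfun_compose adj_works'[OF sl])
    also have "\<dots> = of_real ((norm (B x))\<^sup>2)"
      unfolding BB[symmetric] using adj_works'[OF slB, of "B x" x] saB by (simp add: ell2_inner_self)
    finally have "(norm (T x))\<^sup>2 = (norm (B x))\<^sup>2" unfolding of_real_eq_iff .
    then show ?thesis by simp
  qed
  have "\<forall>n. \<exists>q. ell2_inner (B (ell2_unit n)) (ell2_unit n) = of_real q \<and>
      (norm (B (ell2_unit n)))\<^sup>2 \<le> (norm B + 1) * q"
    using positive_operator_norm_sq_le[OF B] by metis
  then obtain q where q: "\<And>n. ell2_inner (B (ell2_unit n)) (ell2_unit n) = of_real (q n)"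
      "\<And>n. (norm (B (ell2_unit n)))\<^sup>2 \<le> (norm B + 1) * q n"
    by metis
  from s have "summable q" unfolding q by (rule summable_of_realD)
  then have "summable (\<lambda>n. (norm B + 1) * q n)" by (rule summable_mult)
  then have "summable (\<lambda>n. (norm (B (ell2_unit n)))\<^sup>2)"
    by (rule summable_comparison_test_ev[rotated]) (use q in auto)
  then show ?thesis by (simp add: hilbert_schmidt_def eq)
qed

text \<open>The Hilbert-Schmidt inner product of \<open>A\<close> and \<open>C\<close> as a trace;
  the series is dominated by means of 2ab <= a^2 + b^2.\<close>

lemma op_trace_adj_compose:
  assumes C: "hilbert_schmidt C" "scalar_linear C" and A: "hilbert_schmidt A"
  shows "(\<lambda>n. ell2_inner (A (ell2_unit n)) (C (ell2_unit n))) sums op_trace (adj C o\<^sub>L A)"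
proof -
  let ?f = "\<lambda>n. ell2_inner (A (ell2_unit n)) (C (ell2_unit n))"
  have "summable ?f"
  proof (rule summable_comparison_test_ev)
    show "summable (\<lambda>n. (norm (A (ell2_unit n)))\<^sup>2 + (norm (C (ell2_unit n)))\<^sup>2)"
      using C A by (auto simp: hilbert_schmidt_def intro: summable_add)
    have "norm (?f n) \<le> (norm (A (ell2_unit n)))\<^sup>2 + (norm (C (ell2_unit n)))\<^sup>2" for n
    proof -
      have "2 * norm (A (ell2_unit n)) * norm (C (ell2_unit n))
          \<le> (norm (A (ell2_unit n)))\<^sup>2 + (norm (C (ell2_unit n)))\<^sup>2"
        by (rule sum_squares_bound)
      moreover have "0 \<le> norm (A (ell2_unit n)) * norm (C (ell2_unit n))" by simp
      ultimately show ?thesis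
        using norm_ell2_inner_le[of "A (ell2_unit n)" "C (ell2_unit n)"] by linarith
    qed
    then show "\<forall>\<^sub>F n in sequentially. norm (?f n)
        \<le> (norm (A (ell2_unit n)))\<^sup>2 + (norm (C (ell2_unit n)))\<^sup>2"
      by simp
  qed
  moreover have "op_trace (adj C o\<^sub>L A) = suminf ?f"
    by (simp only: op_trace_def blinfun_apply_blinfun_compose adj_works'[OF C(2)])
  ultimately show ?thesis by (simp add: summable_sums)
qed

text \<open>The four traces combine to the squared Hilbert-Schmidt norm of \<open>A - B\<close>,
  which is therefore 0.\<close>

lemma hilbert_schmidt_eqI:
  fixes A B :: "'k::rc_field ell2 \<Rightarrow>\<^sub>L 'k ell2"
  assumes A: "hilbert_schmidt A" "scalar_linear A" and B: "hilbert_schmidt B" "scalar_linear B"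
    and "op_trace (adj A o\<^sub>L A) = op_trace (adj A o\<^sub>L B)"
    and "op_trace (adj B o\<^sub>L A) = op_trace (adj B o\<^sub>L B)"
  shows "A = B"
proof (rule scalar_linear_eqI[OF A(2) B(2)])
  fix m
  let ?D = "\<lambda>n. A (ell2_unit n) - B (ell2_unit n)"
  have "(\<lambda>n. ell2_inner (A (ell2_unit n)) (A (ell2_unit n)) - ell2_inner (B (ell2_unit n)) (A (ell2_unit n))
      - (ell2_inner (A (ell2_unit n)) (B (ell2_unit n)) - ell2_inner (B (ell2_unit n)) (B (ell2_unit n))))
      sums (op_trace (adj A o\<^sub>L A) - op_trace (adj A o\<^sub>L B) - (op_trace (adj B o\<^sub>L A) - op_trace (adj B o\<^sub>L B)))"
    by (intro sums_diff op_trace_adj_compose A B)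
  also have "(\<lambda>n. ell2_inner (A (ell2_unit n)) (A (ell2_unit n)) - ell2_inner (B (ell2_unit n)) (A (ell2_unit n))
      - (ell2_inner (A (ell2_unit n)) (B (ell2_unit n)) - ell2_inner (B (ell2_unit n)) (B (ell2_unit n))))
      = (\<lambda>n. of_real ((norm (?D n))\<^sup>2))"
    unfolding ell2_inner_self[symmetric]
    by (simp add: ell2_inner.diff_left ell2_inner.diff_right algebra_simps)
  finally have s: "(\<lambda>n. of_real ((norm (?D n))\<^sup>2) :: 'k) sums 0" using assms(5,6) by simp
  then have s': "summable (\<lambda>n. (norm (?D n))\<^sup>2)" by (intro summable_of_realD[where 'a='k] sums_summable)
  then have "(\<lambda>n. of_real ((norm (?D n))\<^sup>2) :: 'k) sums of_real (\<Sum>n. (norm (?D n))\<^sup>2)"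
    by (intro sums_of_real summable_sums)
  from sums_unique2[OF s this] have "(\<Sum>n. (norm (?D n))\<^sup>2) = 0"
    by (metis of_real_eq_0_iff)
  then have "(norm (?D m))\<^sup>2 = 0" using s' by (simp add: suminf_eq_zero_iff)
  then show "A (ell2_unit m) = B (ell2_unit m)" by simp
qed

text \<open>Finite rank in coordinate form: the first \<open>N\<close> coordinates are injective on
  the range. There \<open>ell2_nth y n\<close> is the inner product of \<open>y\<close> with
  \<open>P (ell2_unit n)\<close>, so once the tail of \<open>?p\<close> is below 1, the later
  coordinates alone cannot carry the norm of a nonzero \<open>y\<close>.\<close>

lemma hilbert_schmidt_projection_finite_rank:
  assumes hs: "hilbert_schmidt P" and P: "projection P"
  shows "\<exists>N. \<forall>y. P y = y \<longrightarrow> (\<forall>n<N. ell2_nth y n = 0) \<longrightarrow> y = 0"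
proof -
  have sl: "scalar_linear P" and sa: "adj P = P" using P by (auto simp: projection_def)
  let ?p = "\<lambda>n. (norm (P (ell2_unit n)))\<^sup>2"
  have sp: "summable ?p" using hs by (simp add: hilbert_schmidt_def)
  obtain N where N: "norm (\<Sum>n. ?p (n + N)) < 1"
    using suminf_exist_split[OF zero_less_one sp] by blast
  have "y = 0" if y: "P y = y" and 0: "\<forall>n<N. ell2_nth y n = 0" for y
  proof (rule ccontr)
    assume "y \<noteq> 0"
    let ?y = "\<lambda>n. (norm (ell2_nth y n))\<^sup>2"
    have le: "?y n \<le> (norm y)\<^sup>2 * ?p n" for n
    proof -
      have "ell2_nth y n = ell2_inner y (P (ell2_unit n))"
        using adj_works[OF sl, of y "ell2_unit n"] sa y by simp
      then show ?thesis
        by (metis norm_ell2_inner_le norm_ge_zero power_mono power_mult_distrib)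
    qed
    have "(norm y)\<^sup>2 = (\<Sum>n. ?y (n + N)) + (\<Sum>n<N. ?y n)"
      unfolding norm_ell2_sq by (rule suminf_split_initial_segment[OF ell2_summable])
    also have "(\<Sum>n<N. ?y n) = 0" using 0 by simp
    also have "(\<Sum>n. ?y (n + N)) \<le> (\<Sum>n. (norm y)\<^sup>2 * ?p (n + N))"
      using sp by (intro suminf_le le summable_mult summable_ignore_initial_segment ell2_summable)
    also have "\<dots> = (norm y)\<^sup>2 * (\<Sum>n. ?p (n + N))"
      using sp by (intro suminf_mult summable_ignore_initial_segment)
    finally have "(norm y)\<^sup>2 * 1 \<le> (norm y)\<^sup>2 * (\<Sum>n. ?p (n + N))" by simp
    then have "1 \<le> (\<Sum>n. ?p (n + N))"
      using \<open>y \<noteq> 0\<close> by (subst (asm) mult_le_cancel_left_pos) auto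
    with N show False by simp
  qed
  then show ?thesis by blast
qed

section \<open>Powers of self-adjoint operators and partial isometries\<close>

text \<open>Symmetry turns |K^(j+1) z|^2 into <K^(j+2) z, K^j z>, so a vanishing power can be
  lowered one exponent at a time.\<close>

lemma self_adjoint_funpow_kernel:
  fixes K :: "'k::rc_field ell2 \<Rightarrow>\<^sub>L 'k ell2"
  assumes sym: "\<And>x y. ell2_inner (K x) y = ell2_inner x (K y)"
    and "(blinfun_apply K ^^ Suc j) z = 0"
  shows "K z = 0"
  using assms(2)
proof (induction j)
  case (Suc j)
  have "ell2_inner ((blinfun_apply K ^^ Suc j) z) ((blinfun_apply K ^^ Suc j) z) = ell2_inner ((blinfun_apply K ^^ Suc (Suc j)) z) ((blinfun_apply K ^^ j) z)"
    by (simp add: sym)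
  also have "\<dots> = 0" using Suc.prems by (simp add: ell2_inner.zero_left)
  finally have "(blinfun_apply K ^^ Suc j) z = 0" by (simp add: ell2_inner_self)
  then show ?case by (rule Suc.IH)
qed simp

text \<open>The powers occurring here start with \<open>K\<^sup>1\<close>, since \<open>\<S>\<close> need not contain the identity.\<close>

lemma adj_compose_projection:
  fixes \<S> :: "('k::rc_field ell2 \<Rightarrow>\<^sub>L 'k ell2) set"
  assumes sg: "operator_semigroup \<S>" and sa: "self_adjoint_collection \<S>"
    and hs: "\<And>S. S \<in> \<S> \<Longrightarrow> hilbert_schmidt S"
    and fin: "finite (op_trace ` \<S>)"
    and A: "A \<in> \<S>"
  shows "projection (adj A o\<^sub>L A)"
proof -
  define K where "K = adj A o\<^sub>L A"
  have lin: "scalar_linear S" if "S \<in> \<S>" for S using sg that by (auto simp: operator_semigroup_def)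
  have comp: "S o\<^sub>L T \<in> \<S>" if "S \<in> \<S>" "T \<in> \<S>" for S T
    using sg that by (auto simp: operator_semigroup_def)
  have adjS: "adj S \<in> \<S>" if "S \<in> \<S>" for S using sa that by (auto simp: self_adjoint_collection_def)
  have KS: "K \<in> \<S>" unfolding K_def by (intro comp adjS A)
  have KA: "ell2_inner (K x) y = ell2_inner (A x) (A y)" for x y
    by (simp only: K_def blinfun_apply_blinfun_compose adj_works'[OF lin[OF A]])
  have sym: "ell2_inner (K x) y = ell2_inner x (K y)" for x y
    by (metis KA ell2_inner_commute)
  \<comment> \<open>\<open>p j\<close> is K^(j+1), so \<open>c j\<close> below is the trace of
    K^(2j+2).\<close>
  define p where "p j = (((o\<^sub>L) K) ^^ j) K" for j
  have pS: "p j \<in> \<S>" for j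
    unfolding p_def by (induction j) (auto intro: KS comp)
  have p_Suc: "p (Suc j) x = K (p j x)" for j x by (simp add: p_def)
  have p_apply: "p j x = (blinfun_apply K ^^ Suc j) x" for j x
    by (induction j) (simp_all add: p_def)
  have shift: "ell2_inner (p (Suc j) x) y = ell2_inner (p j x) (K y)" for j x y
    by (simp add: p_Suc sym)
  define c where "c j = (\<Sum>n. (norm (p j (ell2_unit n)))\<^sup>2)" for j
  have summ: "summable (\<lambda>n. (norm (p j (ell2_unit n)))\<^sup>2)" for j
    using hs[OF pS] by (simp add: hilbert_schmidt_def)
  have "of_real (c j) = op_trace (adj (p j) o\<^sub>L p j)" for j
  proof -
    have "(\<lambda>n. of_real ((norm (p j (ell2_unit n)))\<^sup>2)) sums op_trace (adj (p j) o\<^sub>L p j)"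
      unfolding ell2_inner_self[symmetric] by (intro op_trace_adj_compose hs lin pS)
    moreover have "(\<lambda>n. of_real ((norm (p j (ell2_unit n)))\<^sup>2)) sums (of_real (c j) :: 'k)"
      unfolding c_def by (intro sums_of_real summable_sums summ)
    ultimately show ?thesis by (rule sums_unique2[symmetric])
  qed
  then have "of_real ` range c \<subseteq> op_trace ` \<S>"
    using pS comp adjS by auto
  then have "finite (of_real ` range c :: 'k set)" using fin finite_subset by blast
  then have finc: "finite (range c)" by (rule finite_imageD) (simp add: inj_on_def)
  let ?d = "\<lambda>j n. (norm (p (j + 2) (ell2_unit n) - p j (ell2_unit n)))\<^sup>2"
  have second: "?d j sums (c (j + 2) - 2 * c (j + 1) + c j)" for j
  proof -
    have "(\<lambda>n. (norm (p (j + 2) (ell2_unit n)))\<^sup>2 - 2 * (norm (p (j + 1) (ell2_unit n)))\<^sup>2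
        + (norm (p j (ell2_unit n)))\<^sup>2) sums (c (j + 2) - 2 * c (j + 1) + c j)"
      unfolding c_def by (intro sums_add sums_diff sums_mult summable_sums summ)
    \<comment> \<open>With y = \<open>p j x\<close>, symmetry of \<open>K\<close> makes both cross
      terms of |K^2 y - y|^2 equal to |K y|^2.\<close>
    moreover have "(norm (p (j + 2) x))\<^sup>2 - 2 * (norm (p (j + 1) x))\<^sup>2 + (norm (p j x))\<^sup>2
        = (norm (p (j + 2) x - p j x))\<^sup>2" for x
    proof -
      have 1: "ell2_inner (p (j + 2) x) (p j x) = of_real ((norm (p (j + 1) x))\<^sup>2)"
        using shift[of "j + 1" x "p j x"] by (simp add: ell2_inner_self[symmetric] p_Suc del: of_real_power)
      have 2: "ell2_inner (p j x) (p (j + 2) x) = of_real ((norm (p (j + 1) x))\<^sup>2)"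
        by (subst ell2_inner_commute) (simp only: 1 rcnj_of_real)
      have "of_real ((norm (p (j + 2) x - p j x))\<^sup>2)
          = (of_real ((norm (p (j + 2) x))\<^sup>2 - 2 * (norm (p (j + 1) x))\<^sup>2 + (norm (p j x))\<^sup>2) :: 'k)"
        unfolding ell2_inner_self[symmetric] ell2_inner.diff_left ell2_inner.diff_right 1 2
        unfolding ell2_inner_self by simp
      then show ?thesis unfolding of_real_eq_iff by simp
    qed
    ultimately show ?thesis by simp
  qed
  have "c (j + 2) - 2 * c (j + 1) + c j \<ge> 0" for j
    by (rule sums_le[OF _ sums_zero second]) simp
  from second_difference_eq_0[OF finc this] obtain j
    where "c (j + 2) - 2 * c (j + 1) + c j = 0" by blast
  with second[of j] have "?d j sums 0" by simp
  then have "?d j n = 0" for n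
    using suminf_eq_zero_iff[of "?d j"] by (simp add: sums_iff)
  then have "p (j + 2) (ell2_unit n) = p j (ell2_unit n)" for n by simp
  then have eq: "p (j + 2) = p j" by (intro scalar_linear_eqI lin pS)
  \<comment> \<open>K^(j+1) annihilates \<open>K (K x) - x\<close>; the kernel lemma lowers the
    exponent to 1.\<close>
  have cube: "K (K (K x)) = K x" for x
  proof -
    have "(blinfun_apply K ^^ Suc j) (K (K x) - x) = p (j + 2) x - p j x"
    proof -
      have "(blinfun_apply K ^^ Suc j) (K (K x) - x) = p j (K (K x)) - p j x"
        by (simp only: p_apply[symmetric] blinfun.diff_right)
      also have "p j (K (K x)) = p (j + 2) x"
        by (simp add: p_apply funpow_swap1)
      finally show ?thesis .
    qed
    then have "(blinfun_apply K ^^ Suc j) (K (K x) - x) = 0" by (simp only: eq diff_self)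
    then have "K (K (K x) - x) = 0" by (rule self_adjoint_funpow_kernel[OF sym])
    then show ?thesis by (simp add: blinfun.diff_right)
  qed
  have idem: "K (K x) = K x" for x
  proof -
    \<comment> \<open>By \<open>cube\<close>, K y = -y, but <K y, y> = |A y|^2 >= 0 excludes the
      eigenvalue -1.\<close>
    define y where "y = K (K x) - K x"
    have "K y = - y" by (simp add: y_def blinfun.diff_right cube)
    then have "of_real ((norm (A y))\<^sup>2) = (of_real (- (norm y)\<^sup>2) :: 'k)"
      unfolding of_real_minus ell2_inner_self[symmetric] KA[symmetric] by (simp add: ell2_inner.minus_left)
    then have "(norm (A y))\<^sup>2 = - (norm y)\<^sup>2" unfolding of_real_eq_iff .
    then have "norm y = 0" by (smt (verit) zero_le_power2 power2_less_eq_zero_iff)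
    then show ?thesis by (simp add: y_def)
  qed
  have "adj K = K" by (intro adj_unique sym)
  moreover have "K o\<^sub>L K = K" by (intro blinfun_eqI) (simp add: idem)
  ultimately have "projection K" using lin[OF KS] by (simp add: projection_def)
  then show ?thesis by (simp add: K_def)
qed

text \<open>\<open>A\<close> is a partial isometry: \<open>adj A o\<^sub>L A\<close> annihilates
  \<open>?y\<close>, hence so does \<open>A\<close>, because <A*A y, y> = |A y|^2. Applied to
  \<open>A\<close> and to \<open>adj A\<close>, this shows that \<open>Q\<close> and
  \<open>P\<close> in the final proof fix the two ranges.\<close>

lemma compose_adj_compose:
  assumes sl: "scalar_linear A" and P: "projection (adj A o\<^sub>L A)"
  shows "A (adj A (A x)) = A x"
proof -
  let ?y = "adj A (A x) - x"
  have "(adj A o\<^sub>L A) ((adj A o\<^sub>L A) x) = (adj A o\<^sub>L A) x"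
    using P unfolding projection_def by (metis blinfun_apply_blinfun_compose)
  then have "adj A (A ?y) = 0" by (simp add: blinfun.diff_right)
  then have "ell2_inner (A ?y) (A ?y) = 0"
    by (simp add: adj_works'[OF sl, symmetric] ell2_inner.zero_left)
  then show ?thesis by (simp add: ell2_inner_self blinfun.diff_right)
qed

section \<open>Finiteness of each fibre and of the semigroup\<close>

text \<open>Finite rank of \<open>P\<close> and \<open>Q\<close> means that a finite corner of the
  matrix determines each operator in \<open>F\<close>. A finite \<open>G\<close> whose corners span
  all corners therefore spans \<open>F\<close>, so the traces against \<open>G\<close>, all in
  \<open>T\<close>, separate \<open>F\<close>.\<close>

lemma finite_fibre:
  fixes F :: "('k::rc_field ell2 \<Rightarrow>\<^sub>L 'k ell2) set"
  assumes lin: "\<And>A. A \<in> F \<Longrightarrow> scalar_linear A" and hs: "\<And>A. A \<in> F \<Longrightarrow> hilbert_schmidt A"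
    and P: "projection P" "hilbert_schmidt P" and Q: "projection Q" "hilbert_schmidt Q"
    and PF: "\<And>A y. A \<in> F \<Longrightarrow> P (adj A y) = adj A y" and QF: "\<And>A x. A \<in> F \<Longrightarrow> Q (A x) = A x"
    and fin: "finite T" and T: "\<And>A B. A \<in> F \<Longrightarrow> B \<in> F \<Longrightarrow> op_trace (adj A o\<^sub>L B) \<in> T"
  shows "finite F"
proof -
  obtain M where M: "\<And>y. P y = y \<Longrightarrow> (\<And>n. n < M \<Longrightarrow> ell2_nth y n = 0) \<Longrightarrow> y = 0"
    using hilbert_schmidt_projection_finite_rank[OF P(2,1)] by blast
  obtain N where N: "\<And>y. Q y = y \<Longrightarrow> (\<And>n. n < N \<Longrightarrow> ell2_nth y n = 0) \<Longrightarrow> y = 0"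
    using hilbert_schmidt_projection_finite_rank[OF Q(2,1)] by blast
  have slP: "P (ell2_scale c x) = ell2_scale c (P x)" and slQ: "Q (ell2_scale c x) = ell2_scale c (Q x)" for c x
    using P Q by (auto simp: projection_def scalar_linear_def)
  define v where "v A = (\<lambda>(m, n). ell2_nth (blinfun_apply A (ell2_unit m)) n)" for A :: "'k ell2 \<Rightarrow>\<^sub>L 'k ell2"
  obtain G where G: "G \<subseteq> F" "finite G"
    and c: "\<forall>A\<in>F. \<exists>c. \<forall>j\<in>{..<M} \<times> {..<N}. v A j = (\<Sum>B\<in>G. c B * v B j)"
    using finite_spanning_subset[of "{..<M} \<times> {..<N}" F v] by auto
  have tr: "\<exists>c. \<forall>X\<in>F. op_trace (adj A o\<^sub>L X) = (\<Sum>B\<in>G. c B * op_trace (adj B o\<^sub>L X))" if A: "A \<in> F" for A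
  proof -
    obtain c where c: "\<And>m n. m < M \<Longrightarrow> n < N \<Longrightarrow>
        ell2_nth (A (ell2_unit m)) n = (\<Sum>B\<in>G. c B * ell2_nth (blinfun_apply B (ell2_unit m)) n)"
      using c A by (auto simp: v_def)
    \<comment> \<open>Both sides are fixed by \<open>Q\<close> and agree in the first
      \<open>N\<close> coordinates.\<close>
    have col: "A (ell2_unit m) = (\<Sum>B\<in>G. ell2_scale (c B) (blinfun_apply B (ell2_unit m)))" if "m < M" for m
    proof -
      have "A (ell2_unit m) - (\<Sum>B\<in>G. ell2_scale (c B) (blinfun_apply B (ell2_unit m))) = 0"
        using G A c[OF that]
        by (intro N) (auto simp: blinfun.diff_right blinfun.sum_right slQ QF intro!: sum.cong)
      then show ?thesis by simp
    qed
    \<comment> \<open>Both sides are fixed by \<open>P\<close>, so the first \<open>M\<close>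
      columns of the operators suffice. Passing to adjoints conjugates the coefficients.\<close>
    have adjA: "adj A y = (\<Sum>B\<in>G. ell2_scale (rcnj (c B)) (blinfun_apply (adj B) y))" for y
    proof -
      have "adj A y - (\<Sum>B\<in>G. ell2_scale (rcnj (c B)) (blinfun_apply (adj B) y)) = 0"
      proof (rule M)
        show "P (adj A y - (\<Sum>B\<in>G. ell2_scale (rcnj (c B)) (blinfun_apply (adj B) y)))
            = adj A y - (\<Sum>B\<in>G. ell2_scale (rcnj (c B)) (blinfun_apply (adj B) y))"
          using G A by (auto simp: blinfun.diff_right blinfun.sum_right slP PF intro!: sum.cong)
      next
        fix m assume m: "m < M"
        have nth: "ell2_nth (blinfun_apply (adj B) y) m = ell2_inner y (blinfun_apply B (ell2_unit m))" if "B \<in> F" for B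
          using adj_works'[OF lin[OF that], of y "ell2_unit m"] by simp
        have "ell2_nth (adj A y) m = (\<Sum>B\<in>G. rcnj (c B) * ell2_inner y (blinfun_apply B (ell2_unit m)))"
          unfolding nth[OF A] col[OF m] ell2_inner.sum_right ell2_inner_scale_right ..
        also have "\<dots> = (\<Sum>B\<in>G. rcnj (c B) * ell2_nth (blinfun_apply (adj B) y) m)"
          using G by (intro sum.cong) (auto simp: nth)
        finally show "ell2_nth (adj A y - (\<Sum>B\<in>G. ell2_scale (rcnj (c B)) (blinfun_apply (adj B) y))) m = 0" by simp
      qed
      then show ?thesis by simp
    qed
    have "op_trace (adj A o\<^sub>L X) = (\<Sum>B\<in>G. rcnj (c B) * op_trace (adj B o\<^sub>L X))" if X: "X \<in> F" for X
    proof -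
      have sB: "(\<lambda>n. ell2_inner (blinfun_apply (adj B) (X (ell2_unit n))) (ell2_unit n)) sums op_trace (adj B o\<^sub>L X)"
        if B: "B \<in> F" for B
        using op_trace_adj_compose[OF hs[OF B] lin[OF B] hs[OF X]]
        by (simp only: adj_works'[OF lin[OF B]])
      have "(\<lambda>n. \<Sum>B\<in>G. rcnj (c B) * ell2_inner (blinfun_apply (adj B) (X (ell2_unit n))) (ell2_unit n))
          sums (\<Sum>B\<in>G. rcnj (c B) * op_trace (adj B o\<^sub>L X))"
        using G by (intro sums_sum sums_mult sB) auto
      also have "(\<lambda>n. \<Sum>B\<in>G. rcnj (c B) * ell2_inner (blinfun_apply (adj B) (X (ell2_unit n))) (ell2_unit n))
          = (\<lambda>n. ell2_inner (adj A (X (ell2_unit n))) (ell2_unit n))"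
        unfolding adjA ell2_inner.sum_left ell2_inner_scale_left ..
      finally show ?thesis using sB[OF A] sums_unique2 by blast
    qed
    then show ?thesis by (intro exI[of _ "\<lambda>B. rcnj (c B)"] ballI)
  qed
  let ?r = "\<lambda>X. restrict (\<lambda>B. op_trace (adj B o\<^sub>L X)) G"
  have "?r ` F \<subseteq> G \<rightarrow>\<^sub>E T" using T G(1) by auto
  moreover have "finite (G \<rightarrow>\<^sub>E T)" using G(2) fin by (intro finite_PiE)
  ultimately have "finite (?r ` F)" by (rule finite_subset)
  moreover have "inj_on ?r F"
  \<comment> \<open>By \<open>tr\<close>, agreement against \<open>G\<close> extends to all of
    \<open>F\<close>, in particular to \<open>X\<close> and \<open>Y\<close> themselves, as
    \<open>hilbert_schmidt_eqI\<close> requires.\<close>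
  proof (rule inj_onI)
    fix X Y assume X: "X \<in> F" and Y: "Y \<in> F" and eq: "?r X = ?r Y"
    have *: "op_trace (adj B o\<^sub>L X) = op_trace (adj B o\<^sub>L Y)" if "B \<in> G" for B
      using fun_cong[OF eq, of B] that by simp
    have "op_trace (adj A o\<^sub>L X) = op_trace (adj A o\<^sub>L Y)" if "A \<in> F" for A
    proof -
      obtain c where "\<forall>X\<in>F. op_trace (adj A o\<^sub>L X) = (\<Sum>B\<in>G. c B * op_trace (adj B o\<^sub>L X))"
        using tr[OF \<open>A \<in> F\<close>] by blast
      with X Y * show ?thesis by simp
    qed
    then show "X = Y" using X Y by (intro hilbert_schmidt_eqI hs lin)
  qed
  ultimately show ?thesis by (rule finite_imageD)
qed

theorem theorem4p5:
  fixes \<S> :: "('k::rc_field ell2 \<Rightarrow>\<^sub>L 'k ell2) set"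
  assumes "operator_semigroup \<S>"
    and "self_adjoint_collection \<S>"
    and "\<forall>S\<in>\<S>. trace_class S"
    and "finite {op_trace S | S. S \<in> \<S>}"
    and "finite {P \<in> \<S>. projection P}"
  shows "finite \<S>"
proof -
  have lin: "scalar_linear S" if "S \<in> \<S>" for S
    using assms(1) that by (auto simp: operator_semigroup_def)
  have comp: "S o\<^sub>L T \<in> \<S>" if "S \<in> \<S>" "T \<in> \<S>" for S T
    using assms(1) that by (auto simp: operator_semigroup_def)
  have adjS: "adj S \<in> \<S>" if "S \<in> \<S>" for S
    using assms(2) that by (auto simp: self_adjoint_collection_def)
  have hs: "hilbert_schmidt S" if "S \<in> \<S>" for S
    using assms(3) that by (auto intro: trace_class_imp_hilbert_schmidt)
  have fin: "finite (op_trace ` \<S>)"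
    using assms(4) by (simp add: Setcompr_eq_image)
  have proj: "projection (adj A o\<^sub>L A)" if "A \<in> \<S>" for A
    by (rule adj_compose_projection[OF assms(1,2) hs fin that])
  have proj': "projection (A o\<^sub>L adj A)" if "A \<in> \<S>" for A
    using proj[OF adjS[OF that]] by (simp add: adj_adj lin that)
  let ?\<P> = "{P \<in> \<S>. projection P}"
  let ?F = "\<lambda>(P, Q). {A \<in> \<S>. adj A o\<^sub>L A = P \<and> A o\<^sub>L adj A = Q}"
  have "finite (?F PQ)" if "PQ \<in> ?\<P> \<times> ?\<P>" for PQ
  proof -
    obtain P Q where PQ: "PQ = (P, Q)" "P \<in> \<S>" "projection P" "Q \<in> \<S>" "projection Q"
      using \<open>PQ \<in> ?\<P> \<times> ?\<P>\<close> by auto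
    have 1: "P (adj A y) = adj A y" if A: "A \<in> ?F PQ" for A y
    proof -
      have "A \<in> \<S>" and P: "adj A o\<^sub>L A = P" using A by (auto simp: PQ)
      then show ?thesis
        using compose_adj_compose[of "adj A" y] proj[OF adjS[OF \<open>A \<in> \<S>\<close>]]
        by (simp add: adj_adj lin adjS flip: P)
    qed
    have 2: "Q (A x) = A x" if A: "A \<in> ?F PQ" for A x
    proof -
      have "A \<in> \<S>" and Q: "A o\<^sub>L adj A = Q" using A by (auto simp: PQ)
      then show ?thesis using compose_adj_compose[of A x] proj by (simp add: lin flip: Q)
    qed
    show ?thesis
      by (rule finite_fibre[where P = P and Q = Q and T = "op_trace ` \<S>"])
        (use PQ fin 1 2 in \<open>auto intro: lin hs comp adjS\<close>)
  qed
  then have "finite (\<Union>PQ\<in>?\<P> \<times> ?\<P>. ?F PQ)"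
    using assms(5) by (intro finite_UN_I) auto
  moreover have "\<S> \<subseteq> (\<Union>PQ\<in>?\<P> \<times> ?\<P>. ?F PQ)"
    using proj proj' comp adjS by auto
  ultimately show ?thesis by (rule finite_subset[rotated])
qed

end
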